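(* For each integer $n\ge 1$ let $z_n=2^{-2n}$, $w_n=2^{-2n}+2^{-n}i$, and let $x_n$ be a real number with $2^{-2(n+1)}<x_n<2^{-2n}$. Let $\gamma_n$ be the polygonal path which goes along straight line segments from $z_n$ to $w_n$, then from $w_n$ to $x_n+2^{-n}i$, then from $x_n+2^{-n}i$ to $x_n$, and then from $x_n$ to $z_{n+1}$. Let $\gamma$ be the rectifiable Jordan arc obtained by gluing together the origin and the paths $\gamma_n$ $(n\ge 1)$, and let $X=\{0\}\cup\bigcup_{n\ge1}\mathrm{Image}(\gamma_n)$ be the image of $\gamma$. Then $D^1(X)$ is incomplete.
   Context: For a perfect compact set $X\subseteq\mathbb{C}$ (non-empty, compact, without isolated points), a function $f:X\to\mathbb{C}$ is complex-differentiable at $a\in X$ if $f'(a)=\lim_{z\to a,\,z\in X\setminus\{a\}}\frac{f(z)-f(a)}{z-a}$ exists. $D^1(X)$ is the normed algebra of all functions on $X$ which are complex-differentiable at every point of $X$ with $f'$ continuous on $X$, with norm $\|f\|=\|f\|_\infty+\|f'\|_\infty$, where $\|\cdot\|_\infty$ is the supremum norm on $X$. *)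

theory Defs
  imports "HOL-Analysis.Analysis" "HOL-Real_Asymp.Real_Asymp"
begin

section \<open>The normed space of continuously complex-differentiable functions\<close>

definition perfect_compact :: "complex set \<Rightarrow> bool" where
  "perfect_compact X \<longleftrightarrow> X \<noteq> {} \<and> compact X \<and> (\<forall>a\<in>X. a islimpt X)"

definition cderiv :: "complex set \<Rightarrow> (complex \<Rightarrow> complex) \<Rightarrow> complex \<Rightarrow> complex" where
  "cderiv X f a = Lim (at a within X) (\<lambda>z. (f z - f a) / (z - a))"

text \<open>
  A function on \<open>X\<close> is represented by its unique extension that is \<open>undefined\<close> outside \<open>X\<close>.
  The notions below depend only on the values of the function on \<open>X\<close>.
\<close>

definition D1 :: "complex set \<Rightarrow> (complex \<Rightarrow> complex) set" where
  "D1 X = {f \<in> extensional X. (\<forall>a\<in>X. f field_differentiable (at a within X))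
             \<and> continuous_on X (cderiv X f)}"

definition sup_norm_on :: "complex set \<Rightarrow> (complex \<Rightarrow> complex) \<Rightarrow> real" where
  "sup_norm_on X f = (SUP z\<in>X. cmod (f z))"

definition D1_norm :: "complex set \<Rightarrow> (complex \<Rightarrow> complex) \<Rightarrow> real" where
  "D1_norm X f = sup_norm_on X f + sup_norm_on X (cderiv X f)"

text \<open>
  The metric of the norm. The value \<open>0\<close> outside \<open>D1 X\<close> is needed because the locale
  \<open>Metric_space\<close> requires non-negativity and symmetry for all elements of the type.
\<close>

definition D1_dist :: "complex set \<Rightarrow> (complex \<Rightarrow> complex) \<Rightarrow> (complex \<Rightarrow> complex) \<Rightarrow> real" where
  "D1_dist X f g = (if f \<in> D1 X \<and> g \<in> D1 X then D1_norm X (\<lambda>z. f z - g z) else 0)"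

lemma cderiv_eqI:
  assumes "a islimpt X" "(f has_field_derivative d) (at a within X)"
  shows "cderiv X f a = d"
  using assms unfolding cderiv_def has_field_derivative_iff
  by (intro tendsto_Lim) (auto simp: trivial_limit_within)

lemma D1_has_field_derivative:
  assumes "perfect_compact X" "f \<in> D1 X" "a \<in> X"
  shows "(f has_field_derivative cderiv X f a) (at a within X)"
  using assms cderiv_eqI unfolding perfect_compact_def D1_def field_differentiable_def by blast

lemma cderiv_diff:
  assumes "perfect_compact X" "f \<in> D1 X" "g \<in> D1 X" "a \<in> X"
  shows "cderiv X (\<lambda>z. f z - g z) a = cderiv X f a - cderiv X g a"
  using assms by (intro cderiv_eqI DERIV_diff D1_has_field_derivative) (auto simp: perfect_compact_def)

lemma D1_continuous_on:
  assumes "f \<in> D1 X" shows "continuous_on X f" "continuous_on X (cderiv X f)"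
  using assms field_differentiable_imp_continuous_at
  by (auto simp: D1_def continuous_on_eq_continuous_within)

lemma sup_norm_on_upper:
  assumes "compact X" "continuous_on X f" "z \<in> X"
  shows "cmod (f z) \<le> sup_norm_on X f"
  unfolding sup_norm_on_def using assms
  by (intro cSUP_upper bounded_imp_bdd_above compact_imp_bounded compact_continuous_image
        continuous_intros) auto

lemma sup_norm_on_triangle:
  assumes "compact X" "X \<noteq> {}" "continuous_on X f" "continuous_on X g"
    and "\<And>z. z \<in> X \<Longrightarrow> cmod (h z) \<le> cmod (f z) + cmod (g z)"
  shows "sup_norm_on X h \<le> sup_norm_on X f + sup_norm_on X g"
  unfolding sup_norm_on_def[of X h]
proof (rule cSUP_least)
  fix z assume "z \<in> X"
  with assms sup_norm_on_upper[of X f z] sup_norm_on_upper[of X g z]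
  show "cmod (h z) \<le> sup_norm_on X f + sup_norm_on X g" by force
qed (use assms in auto)

lemma sup_norm_on_nonneg:
  assumes "compact X" "X \<noteq> {}" "continuous_on X f"
  shows "0 \<le> sup_norm_on X f"
proof -
  obtain z where "z \<in> X" using assms by blast
  from sup_norm_on_upper[OF assms(1,3) this] show ?thesis
    using norm_ge_zero order_trans by blast
qed

lemma D1_dist_eq:
  assumes "perfect_compact X" "f \<in> D1 X" "g \<in> D1 X"
  shows "D1_dist X f g = sup_norm_on X (\<lambda>z. f z - g z)
           + sup_norm_on X (\<lambda>z. cderiv X f z - cderiv X g z)"
  unfolding D1_dist_def D1_norm_def sup_norm_on_def using cderiv_diff[OF assms] assms by simp

theorem Metric_space_D1:
  assumes X: "perfect_compact X"
  shows "Metric_space (D1 X) (D1_dist X)"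
proof
  have cX: "compact X" "X \<noteq> {}" using X by (auto simp: perfect_compact_def)
  note cont = D1_continuous_on
  show "0 \<le> D1_dist X f g" for f g
  proof (cases "f \<in> D1 X \<and> g \<in> D1 X")
    case True
    then show ?thesis
      by (simp only: D1_dist_eq[OF X])
         (intro add_nonneg_nonneg sup_norm_on_nonneg cX continuous_intros cont; simp)
  qed (auto simp: D1_dist_def)
  show "D1_dist X f g = D1_dist X g f" for f g
  proof (cases "f \<in> D1 X \<and> g \<in> D1 X")
    case True
    then show ?thesis
      by (simp add: D1_dist_eq[OF X] sup_norm_on_def norm_minus_commute)
  qed (auto simp: D1_dist_def)
  show "D1_dist X f g = 0 \<longleftrightarrow> f = g" if fg: "f \<in> D1 X" "g \<in> D1 X" for f g
  proof
    assume "f = g"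
    then show "D1_dist X f g = 0" using cX fg by (simp add: D1_dist_eq[OF X] sup_norm_on_def)
  next
    assume "D1_dist X f g = 0"
    moreover have "0 \<le> sup_norm_on X (\<lambda>z. f z - g z)"
      and "0 \<le> sup_norm_on X (\<lambda>z. cderiv X f z - cderiv X g z)"
      by (intro sup_norm_on_nonneg cX continuous_intros cont fg)+
    ultimately have 0: "sup_norm_on X (\<lambda>z. f z - g z) = 0"
      unfolding D1_dist_eq[OF X fg] by linarith
    have "f z = g z" if "z \<in> X" for z
    proof -
      have "cmod (f z - g z) \<le> sup_norm_on X (\<lambda>z. f z - g z)"
        by (rule sup_norm_on_upper) (intro cX continuous_intros cont fg that)+
      with 0 show ?thesis by simp
    qed
    then show "f = g" using fg by (auto simp: D1_def intro: extensionalityI)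
  qed
  show "D1_dist X f h \<le> D1_dist X f g + D1_dist X g h"
    if fgh: "f \<in> D1 X" "g \<in> D1 X" "h \<in> D1 X" for f g h
  proof -
    have tri: "cmod (a - c) \<le> cmod (a - b) + cmod (b - c)" for a b c
      using norm_triangle_ineq[of "a - b" "b - c"] by simp
    have "sup_norm_on X (\<lambda>z. f z - h z)
        \<le> sup_norm_on X (\<lambda>z. f z - g z) + sup_norm_on X (\<lambda>z. g z - h z)"
      by (rule sup_norm_on_triangle) (intro cX continuous_intros cont fgh tri)+
    moreover have "sup_norm_on X (\<lambda>z. cderiv X f z - cderiv X h z)
        \<le> sup_norm_on X (\<lambda>z. cderiv X f z - cderiv X g z)
          + sup_norm_on X (\<lambda>z. cderiv X g z - cderiv X h z)"
      by (rule sup_norm_on_triangle) (intro cX continuous_intros cont fgh tri)+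
    ultimately show ?thesis
      unfolding D1_dist_eq[OF X fgh(1,2)] D1_dist_eq[OF X fgh(2,3)] D1_dist_eq[OF X fgh(1,3)]
      by linarith
  qed
qed


section \<open>The polygonal arc\<close>

definition vz :: "nat \<Rightarrow> complex" where
  "vz n = Complex (1 / 2 ^ (2 * n)) 0"

definition vw :: "nat \<Rightarrow> complex" where
  "vw n = Complex (1 / 2 ^ (2 * n)) (1 / 2 ^ n)"

definition gamma_path :: "(nat \<Rightarrow> real) \<Rightarrow> nat \<Rightarrow> real \<Rightarrow> complex" where
  "gamma_path x n =
     linepath (vz n) (vw n) +++ linepath (vw n) (Complex (x n) (1 / 2 ^ n)) +++
     linepath (Complex (x n) (1 / 2 ^ n)) (Complex (x n) 0) +++
     linepath (Complex (x n) 0) (vz (Suc n))"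

text \<open>
  The image of the arc glued together from the origin and the paths \<open>gamma_path x n\<close>, \<open>n \<ge> 1\<close>.
\<close>

definition arc_image :: "(nat \<Rightarrow> real) \<Rightarrow> complex set" where
  "arc_image x = insert 0 (\<Union>n\<in>{1..}. path_image (gamma_path x n))"

lemma path_gamma_path: "path (gamma_path x n)"
  unfolding gamma_path_def by (intro path_join_imp path_linepath) auto

lemma path_image_gamma_path:
  "path_image (gamma_path x n) =
     closed_segment (vz n) (vw n) \<union> closed_segment (vw n) (Complex (x n) (1 / 2 ^ n)) \<union>
     closed_segment (Complex (x n) (1 / 2 ^ n)) (Complex (x n) 0) \<union>
     closed_segment (Complex (x n) 0) (vz (Suc n))"
  unfolding gamma_path_def by (simp add: path_image_join Un_assoc)

lemma path_image_gamma_path_bound: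
  assumes x: "0 < x n" "x n < 1 / 2 ^ (2 * n)" and p: "p \<in> path_image (gamma_path x n)"
  shows "cmod p \<le> 2 / 2 ^ n"
proof -
  have conv: "convex (cball (0::complex) (2 / 2 ^ n))" by simp
  have 1: "(1::real) / 2 ^ (2 * n) \<le> 1 / 2 ^ n"
    by (intro divide_left_mono power_increasing) auto
  have 2: "(1::real) / 2 ^ (2 * Suc n) \<le> 1 / 2 ^ n"
    by (intro divide_left_mono power_increasing) auto
  have C: "cmod (Complex a b) \<le> 2 / 2 ^ n"
    if "0 \<le> a" "a \<le> 1 / 2 ^ n" "0 \<le> b" "b \<le> 1 / 2 ^ n" for a b
    using cmod_le[of "Complex a b"] that by simp
  have "vz n \<in> cball 0 (2 / 2 ^ n)" "vz (Suc n) \<in> cball 0 (2 / 2 ^ n)" "vw n \<in> cball 0 (2 / 2 ^ n)"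
    "Complex (x n) (1 / 2 ^ n) \<in> cball 0 (2 / 2 ^ n)" "Complex (x n) 0 \<in> cball 0 (2 / 2 ^ n)"
    using x 1 2 unfolding vz_def vw_def mem_cball_0 by (intro C; simp)+
  then have "path_image (gamma_path x n) \<subseteq> cball 0 (2 / 2 ^ n)"
    unfolding path_image_gamma_path by (intro Un_least closed_segment_subset conv)
  with p show ?thesis by auto
qed

theorem perfect_compact_arc_image:
  assumes x: "\<And>n. n \<ge> 1 \<Longrightarrow> 1 / 2 ^ (2 * (n + 1)) < x n \<and> x n < 1 / 2 ^ (2 * n)"
  shows "perfect_compact (arc_image x)"
  unfolding perfect_compact_def
proof (intro conjI ballI)
  let ?P = "\<lambda>n. path_image (gamma_path x n)"
  have xpos: "0 < x n" if "n \<ge> 1" for n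
    using x[OF that] less_trans[of 0 "1 / 2 ^ (2 * (n + 1))" "x n"] by simp
  have bd: "cmod p \<le> 2 / 2 ^ n" if "n \<ge> 1" "p \<in> ?P n" for n p
    using path_image_gamma_path_bound that xpos x by blast
  have lim: "(\<lambda>n. 2 / 2 ^ n :: real) \<longlonglongrightarrow> 0"
    by real_asymp
  show "arc_image x \<noteq> {}" by (simp add: arc_image_def)
  show "compact (arc_image x)"
  proof (rule compactI)
    fix \<C> :: "complex set set"
    assume op: "\<forall>T\<in>\<C>. open T" and cov: "arc_image x \<subseteq> \<Union>\<C>"
    then obtain U where U: "U \<in> \<C>" "0 \<in> U" by (auto simp: arc_image_def)
    then obtain e where e: "e > 0" "ball 0 e \<subseteq> U" using op open_contains_ball by metis
    from order_tendstoD(2)[OF lim e(1)] obtain N where N: "2 / 2 ^ n < e" if "n \<ge> N" for n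
      unfolding eventually_sequentially by auto
    have "compact (\<Union>n\<in>{1..N}. ?P n)"
      by (intro compact_UN) (auto intro: compact_path_image path_gamma_path)
    moreover have "(\<Union>n\<in>{1..N}. ?P n) \<subseteq> \<Union>\<C>"
      by (rule order_trans[OF _ cov]) (auto simp: arc_image_def)
    ultimately obtain \<D> where D: "\<D> \<subseteq> \<C>" "finite \<D>" "(\<Union>n\<in>{1..N}. ?P n) \<subseteq> \<Union>\<D>"
      using op by (metis compactE)
    have "arc_image x \<subseteq> \<Union>(insert U \<D>)"
    proof
      fix p assume "p \<in> arc_image x"
      then consider "p = 0" | n where "n \<ge> 1" "p \<in> ?P n" by (auto simp: arc_image_def)
      then show "p \<in> \<Union>(insert U \<D>)"
      proof cases
        case 1 then show ?thesis using U by simp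
      next
        case 2
        show ?thesis
        proof (cases "n \<le> N")
          case True with 2 D show ?thesis by fastforce
        next
          case False
          then have "cmod p < e" using bd[OF 2] N[of n] by simp
          then show ?thesis using e by auto
        qed
      qed
    qed
    then show "\<exists>\<D>\<subseteq>\<C>. finite \<D> \<and> arc_image x \<subseteq> \<Union>\<D>"
      using D U by (intro exI[of _ "insert U \<D>"]) auto
  qed
next
  let ?P = "\<lambda>n. path_image (gamma_path x n)"
  have vzP: "vz n \<in> ?P n" "vw n \<in> ?P n" for n
    by (auto simp: path_image_gamma_path)
  have vz_nz: "vz n \<noteq> 0" for n by (simp add: vz_def complex_eq_iff)
  have vz_in: "vz (Suc n) \<in> arc_image x - {0}" for n
    using vzP vz_nz by (force simp: arc_image_def)
  fix a assume "a \<in> arc_image x"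
  then consider "a = 0" | n where "n \<ge> 1" "a \<in> ?P n" by (auto simp: arc_image_def)
  then show "a islimpt arc_image x"
  proof cases
    case 1
    have "(\<lambda>n. vz (Suc n)) \<longlonglongrightarrow> 0"
    proof (rule tendsto_norm_zero_cancel)
      have "(\<lambda>n. 1 / 2 ^ (2 * Suc n) :: real) \<longlonglongrightarrow> 0" by real_asymp
      then show "(\<lambda>n. cmod (vz (Suc n))) \<longlonglongrightarrow> 0"
        by (simp add: vz_def complex_norm)
    qed
    then show ?thesis unfolding 1 islimpt_sequential
      using vz_in by (intro exI[of _ "\<lambda>n. vz (Suc n)"]) auto
  next
    case 2
    have "vz n \<noteq> vw n" by (simp add: vz_def vw_def complex_eq_iff)
    then have "\<nexists>p. ?P n = {p}" using vzP[of n] by force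
    then have "a islimpt ?P n"
      using 2 connected_path_image[OF path_gamma_path] by (intro connected_imp_perfect) auto
    then show ?thesis
      by (rule islimpt_subset) (use 2 in \<open>auto simp: arc_image_def\<close>)
  qed
qed

end

theory Submission
  imports Defs
begin

text \<open>
  The arc has infinite slope at the origin: it climbs to height \<open>2 ^ -n\<close> at distance about
  \<open>4 ^ -n\<close> from the origin. Let \<open>h\<^sub>n\<close> be constant off the \<open>n\<close>-th ascending segment and drop
  smoothly from \<open>1\<close> to \<open>0\<close> along that segment. Then \<open>\<bar>h\<^sub>n'\<bar> = O(2 ^ n)\<close>, so the series
  \<open>\<Sum>n. h\<^sub>n / 3 ^ n\<close> is Cauchy in \<open>D1\<close>. Its pointwise limit vanishes at \<open>0\<close> and is at
  least \<open>3 ^ -n\<close> at \<open>4 ^ -n\<close>, so it is not differentiable at \<open>0\<close>.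
\<close>

section \<open>Smooth steps along a vertical segment\<close>

text \<open>The local shape of the arc around one ascending segment: a plateau at height
  \<open>b\<close> on the left, the segment over \<open>a\<close>, the real axis on the right. Only
  an inclusion is demanded, and the strip is open, so that every limit at a point over
  \<open>a\<close> sees this shape alone.\<close>

definition vertical_segment_in_strip ::
    "complex set \<Rightarrow> real \<Rightarrow> real \<Rightarrow> real \<Rightarrow> real \<Rightarrow> bool" where
  "vertical_segment_in_strip X p q a b \<longleftrightarrow> p < a \<and> a < q \<and> 0 < b \<and>
     (\<forall>z\<in>X. p < Re z \<longrightarrow> Re z < q \<longrightarrow>
        Re z < a \<and> Im z = b \<or> Re z = a \<and> 0 \<le> Im z \<and> Im z \<le> b \<or> a < Re z \<and> Im z = 0)"

text \<open>With \<open>t = Im z / b\<close>, the cubic takes the value 1 at \<open>t = 0\<close>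
  and 0 at \<open>t = 1\<close> and has zero slope at both, so on such a set it joins the two
  constants smoothly.\<close>

definition step :: "real \<Rightarrow> real \<Rightarrow> complex \<Rightarrow> complex" where
  "step a b z = (if Re z < a then 0 else if a < Re z then 1
                 else of_real (1 - 3 * (Im z / b)\<^sup>2 + 2 * (Im z / b) ^ 3))"

text \<open>On the segment \<open>z = a + i y\<close>, so the complex derivative is the
  \<open>y\<close>-derivative of the cubic divided by \<open>\<i>\<close>.\<close>

definition step_deriv :: "real \<Rightarrow> real \<Rightarrow> complex \<Rightarrow> complex" where
  "step_deriv a b z = (if Re z = a then of_real (6 * ((Im z / b)\<^sup>2 - Im z / b) / b) / \<i> else 0)"

text \<open>The height is \<open>b\<close> left of the segment and 0 right of it, where the cubic
  and its derivative already have the constant values. One formula thus covers both corners.\<close>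

lemma step_in_strip:
  assumes "vertical_segment_in_strip X p q a b" "z \<in> X" "p < Re z" "Re z < q"
  shows "step a b z = of_real (1 - 3 * (Im z / b)\<^sup>2 + 2 * (Im z / b) ^ 3)"
    and "step_deriv a b z = of_real (6 * ((Im z / b)\<^sup>2 - Im z / b) / b) / \<i>"
  using assms unfolding vertical_segment_in_strip_def step_def step_deriv_def by force+

lemma eventually_at_within_Re_in:
  assumes "open I" "Re w \<in> I"
  shows "eventually (\<lambda>z. z \<in> X \<and> Re z \<in> I) (at w within X)"
proof -
  have "(Re \<longlongrightarrow> Re w) (at w within X)" by (intro tendsto_intros)
  from topological_tendstoD[OF this assms] show ?thesis
    by (auto simp: eventually_at_filter elim: eventually_mono)
qed

lemma eventually_at_within_Im_in:
  assumes "open I" "Im w \<in> I"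
  shows "eventually (\<lambda>z. Im z \<in> I) (at w within X)"
  by (rule topological_tendstoD[OF _ assms]) (intro tendsto_intros)

lemma step_has_field_derivative:
  assumes V: "vertical_segment_in_strip X p q a b" and w: "w \<in> X"
  shows "(step a b has_field_derivative step_deriv a b w) (at w within X)"
proof -
  have pq: "p < a" "a < q" "0 < b" using V by (auto simp: vertical_segment_in_strip_def)
  consider "Re w < a" | "a < Re w" | "Re w = a" by linarith
  then show ?thesis
  proof cases
    case 1
    have "eventually (\<lambda>z. step a b z = 0) (at w within X)"
      using eventually_at_within_Re_in[of "{..<a}" w X] 1
      by (auto simp: step_def elim!: eventually_mono)
    moreover have "step a b w = 0" using 1 by (simp add: step_def)
    ultimately have "(step a b has_field_derivative 0) (at w within X)"
      by (subst has_field_derivative_cong_eventually) auto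
    with 1 show ?thesis by (simp add: step_deriv_def)
  next
    case 2
    have "eventually (\<lambda>z. step a b z = 1) (at w within X)"
      using eventually_at_within_Re_in[of "{a<..}" w X] 2
      by (auto simp: step_def elim!: eventually_mono)
    moreover have "step a b w = 1" using 2 by (simp add: step_def)
    ultimately have "(step a b has_field_derivative 0) (at w within X)"
      by (subst has_field_derivative_cong_eventually) auto
    with 2 show ?thesis by (simp add: step_deriv_def)
  next
    case 3
    \<comment> \<open>\<open>r\<close> depends on \<open>Im z\<close> only. This is compatible with complex differentiability because the
      derivative of the cubic vanishes at both ends, while strictly between them \<open>Re z\<close> is constant.\<close>
    define r where "r z = complex_of_real (1 - 3 * (Im z / b)\<^sup>2 + 2 * (Im z / b) ^ 3)" for z
    have strip: "eventually (\<lambda>z. z \<in> X \<and> Re z \<in> {p<..<q}) (at w within X)"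
      using 3 pq by (intro eventually_at_within_Re_in) auto
    have "eventually (\<lambda>z. step a b z = r z) (at w within X)"
      using strip by (rule eventually_mono) (use step_in_strip[OF V] in \<open>auto simp: r_def\<close>)
    moreover have "step a b w = r w" using 3 by (simp add: step_def r_def)
    ultimately have eq: "(step a b has_field_derivative d) (at w within X) \<longleftrightarrow>
        (r has_field_derivative d) (at w within X)" for d
      by (rule has_field_derivative_cong_eventually)
    consider "Im w = 0 \<or> Im w = b" | "0 < Im w" "Im w < b"
      using V w 3 pq by (force simp: vertical_segment_in_strip_def)
    then show ?thesis
    proof cases
      case 1
      then have "step_deriv a b w = 0"
        using pq by (auto simp: step_deriv_def)
      \<comment> \<open>At an end of the segment the real derivative of \<open>r\<close> is the zero
        map, which is multiplication by the complex number 0.\<close>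
      moreover have "(r has_derivative (\<lambda>h. 0)) (at w within X)"
        unfolding r_def by (rule derivative_eq_intros refl | use 1 pq in \<open>force\<close>)+
      then have "(r has_field_derivative 0) (at w within X)"
        by (rule has_derivative_imp_has_field_derivative) simp
      ultimately show ?thesis by (simp add: eq)
    next
      case 2
      \<comment> \<open>The same cubic as a complex polynomial. It agrees with \<open>r\<close> on
        the line over \<open>a\<close>, which contains all points of \<open>X\<close> near an
        interior point of the segment.\<close>
      define s where "s z = 1 - 3 * ((z - of_real a) / (\<i> * b))\<^sup>2 + 2 * ((z - of_real a) / (\<i> * b)) ^ 3" for z
      have im: "(z - of_real a) / (\<i> * b) = of_real (Im z / b)" if "Re z = a" for z
        using that pq by (auto simp: complex_eq_iff Re_divide Im_divide power2_eq_square)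
      have "eventually (\<lambda>z. Im z \<in> {0<..<b}) (at w within X)"
        using 2 by (intro eventually_at_within_Im_in) auto
      with strip have "eventually (\<lambda>z. r z = s z) (at w within X)"
      proof eventually_elim
        case (elim z)
        then have "Re z = a" using V by (force simp: vertical_segment_in_strip_def)
        then show ?case by (simp add: im r_def s_def)
      qed
      moreover have "r w = s w" using 3 by (simp add: im r_def s_def)
      ultimately have eq': "(r has_field_derivative d) (at w within X) \<longleftrightarrow>
          (s has_field_derivative d) (at w within X)" for d
        by (rule has_field_derivative_cong_eventually)
      let ?t = "(w - of_real a) / (\<i> * b)"
      have "(s has_field_derivative (6 * (?t\<^sup>2 - ?t) / (\<i> * b))) (at w within X)"
        unfolding s_def
        by (rule derivative_eq_intros refl | use pq in \<open>simp add: field_simps power2_eq_square\<close>)+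
      moreover have "6 * (?t\<^sup>2 - ?t) / (\<i> * b) = step_deriv a b w"
        unfolding im[OF 3] step_deriv_def using 3 pq by (simp add: field_simps)
      ultimately show ?thesis by (simp only: eq eq')
    qed
  qed
qed

text \<open>Off the line over \<open>a\<close> the derivative is locally zero. On it, the single
  formula of the strip is continuous in \<open>Im z\<close>.\<close>

lemma step_deriv_continuous_on:
  assumes V: "vertical_segment_in_strip X p q a b"
  shows "continuous_on X (step_deriv a b)"
  unfolding continuous_on_def
proof
  fix w assume w: "w \<in> X"
  have pq: "p < a" "a < q" "0 < b" using V by (auto simp: vertical_segment_in_strip_def)
  show "(step_deriv a b \<longlongrightarrow> step_deriv a b w) (at w within X)"
  proof (cases "Re w = a")
    case False
    have "eventually (\<lambda>z. step_deriv a b z = 0) (at w within X)"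
      using eventually_at_within_Re_in[OF open_Compl[OF closed_singleton[of a]], of w X] False
      by (auto simp: step_deriv_def elim!: eventually_mono)
    moreover have "step_deriv a b w = 0" using False by (simp add: step_deriv_def)
    ultimately show ?thesis by (simp only: tendsto_eventually)
  next
    case True
    let ?d = "\<lambda>z. complex_of_real (6 * ((Im z / b)\<^sup>2 - Im z / b) / b) / \<i>"
    have strip: "eventually (\<lambda>z. z \<in> X \<and> Re z \<in> {p<..<q}) (at w within X)"
      using True pq by (intro eventually_at_within_Re_in) auto
    have "eventually (\<lambda>z. step_deriv a b z = ?d z) (at w within X)"
      using strip by (rule eventually_mono) (use step_in_strip[OF V] in auto)
    moreover have "(?d \<longlongrightarrow> ?d w) (at w within X)"
      by (intro tendsto_intros) (use pq in auto)
    moreover have "step_deriv a b w = ?d w" using True by (simp add: step_deriv_def)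
    ultimately show ?thesis by (simp add: tendsto_cong)
  qed
qed

lemma step_bounds:
  assumes V: "vertical_segment_in_strip X p q a b" and z: "z \<in> X"
  shows "step a b z \<in> \<real>" "0 \<le> Re (step a b z)" "Re (step a b z) \<le> 1"
    and "cmod (step_deriv a b z) \<le> 2 / b"
proof -
  define t where "t = Im z / b"
  have pq: "p < a" "a < q" "0 < b" using V by (auto simp: vertical_segment_in_strip_def)
  have t: "0 \<le> t" "t \<le> 1" if "Re z = a"
    using V z pq that by (force simp: vertical_segment_in_strip_def t_def)+
  \<comment> \<open>Both factorisations make the sign on the unit interval evident.\<close>
  have poly: "1 - 3 * t\<^sup>2 + 2 * t ^ 3 = (1 - t)\<^sup>2 * (1 + 2 * t)"
    "3 * t\<^sup>2 - 2 * t ^ 3 = t\<^sup>2 * (3 - 2 * t)"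
    by (simp_all add: algebra_simps power2_eq_square power3_eq_cube)
  show "step a b z \<in> \<real>" by (simp add: step_def del: of_real_add of_real_diff)
  have "0 \<le> 1 - 3 * t\<^sup>2 + 2 * t ^ 3" if "Re z = a"
    unfolding poly using t[OF that] by simp
  then show "0 \<le> Re (step a b z)"
    by (auto simp: step_def t_def simp del: of_real_add of_real_diff)
  have "0 \<le> 3 * t\<^sup>2 - 2 * t ^ 3" if "Re z = a"
    unfolding poly using t[OF that] by simp
  then show "Re (step a b z) \<le> 1"
    by (auto simp: step_def t_def simp del: of_real_add of_real_diff)
  \<comment> \<open>This gives 6/4 as the bound for the numerator; it is rounded up to 2.\<close>
  have "\<bar>t\<^sup>2 - t\<bar> \<le> 1 / 4" if "Re z = a"
  proof -
    have "t\<^sup>2 - t \<le> 0" using t[OF that] by (simp add: power2_eq_square mult_left_le)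
    moreover have "0 \<le> (t - 1 / 2)\<^sup>2" by simp
    then have "- (1 / 4) \<le> t\<^sup>2 - t" by (simp add: power2_eq_square algebra_simps)
    ultimately show ?thesis by linarith
  qed
  then have "\<bar>6 * (t\<^sup>2 - t)\<bar> / b \<le> 2 / b" if "Re z = a"
    using that pq unfolding abs_mult by (intro divide_right_mono) auto
  then show "cmod (step_deriv a b z) \<le> 2 / b"
    using pq by (auto simp: step_deriv_def norm_divide norm_mult t_def
      simp del: of_real_diff of_real_mult of_real_divide)
qed

section \<open>The polygonal arc near its ascending segments\<close>

text \<open>The four segments in the order of traversal. The descending one is recorded by its real
  part alone, because the strips considered next are bounded by these lines and exclude
  them.\<close>

lemma mem_path_image_gamma_path:
  assumes "1 / 2 ^ (2 * (n + 1)) < x n" "x n < 1 / 2 ^ (2 * n)"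
    and "z \<in> path_image (gamma_path x n)"
  shows "Re z = 1 / 2 ^ (2 * n) \<and> 0 \<le> Im z \<and> Im z \<le> 1 / 2 ^ n \<or>
         x n \<le> Re z \<and> Re z \<le> 1 / 2 ^ (2 * n) \<and> Im z = 1 / 2 ^ n \<or>
         Re z = x n \<or>
         1 / 2 ^ (2 * (n + 1)) \<le> Re z \<and> Re z \<le> x n \<and> Im z = 0"
proof -
  have "closed_segment 0 (1 / 2 ^ n) = {0..1 / 2 ^ n :: real}"
    by (simp add: closed_segment_eq_real_ivl)
  with assms show ?thesis
    by (auto simp: path_image_gamma_path vz_def vw_def closed_segment_same_Re closed_segment_same_Im
        closed_segment_eq_real_ivl split: if_splits)
qed

text \<open>The strip lies between two consecutive descending segments. Paths with index
  \<open>m < n\<close> stay at real parts at least \<open>1 / 2 ^ (2 * n)\<close>, beyond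
  \<open>x n\<close>; those with \<open>m \<ge> n + 2\<close> stay left of \<open>x (Suc n)\<close>.
  Only the last segment of path \<open>n\<close> and the first two of path \<open>Suc n\<close>
  remain.\<close>

lemma vertical_segment_in_strip_arc_image:
  assumes x: "\<And>n. n \<ge> 1 \<Longrightarrow> 1 / 2 ^ (2 * (n + 1)) < x n \<and> x n < 1 / 2 ^ (2 * n)"
    and n: "n \<ge> 1"
  shows "vertical_segment_in_strip (arc_image x) (x (Suc n)) (x n) (1 / 2 ^ (2 * Suc n)) (1 / 2 ^ Suc n)"
  unfolding vertical_segment_in_strip_def
proof (intro conjI ballI impI)
  show "x (Suc n) < 1 / 2 ^ (2 * Suc n)" "1 / 2 ^ (2 * Suc n) < x n"
    using x[of "Suc n"] x[of n] n by auto
  show "0 < (1 / 2 ^ Suc n :: real)" by simp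
  fix z assume z: "z \<in> arc_image x" "x (Suc n) < Re z" "Re z < x n"
  \<comment> \<open>Positive real parts in the strip exclude the origin.\<close>
  have "0 < x (Suc n)"
    using x[of "Suc n"] less_trans[of 0 "1 / 2 ^ (2 * (Suc n + 1))" "x (Suc n)"] by simp
  with z obtain m where m: "m \<ge> 1" "z \<in> path_image (gamma_path x m)"
    by (auto simp: arc_image_def)
  note xm = x[OF m(1), THEN conjunct1] x[OF m(1), THEN conjunct2]
  note g = mem_path_image_gamma_path[OF xm m(2)]
  have ge: "1 / 2 ^ (2 * (m + 1)) \<le> Re z" and le: "Re z \<le> 1 / 2 ^ (2 * m)"
    using g xm by linarith+
  have pow: "1 / 2 ^ (2 * k) \<le> (1 / 2 ^ (2 * j) :: real)" if "j \<le> k" for j k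
    using that by (intro divide_left_mono power_increasing) auto
  consider "m < n" | "m = n" | "m = Suc n" | "Suc (Suc n) \<le> m" by linarith
  then show "Re z < 1 / 2 ^ (2 * Suc n) \<and> Im z = 1 / 2 ^ Suc n \<or>
      Re z = 1 / 2 ^ (2 * Suc n) \<and> 0 \<le> Im z \<and> Im z \<le> 1 / 2 ^ Suc n \<or>
      1 / 2 ^ (2 * Suc n) < Re z \<and> Im z = 0"
  proof cases
    case 1
    with pow[of "m + 1" n] ge x[OF n] z show ?thesis by linarith
  next
    case 2
    have "Re z \<ge> 1 / 2 ^ (2 * (n + 1)) \<and> Im z = 0"
      using g z(3) xm unfolding 2 by linarith
    then show ?thesis by auto
  next
    case 3
    have "0 \<le> (1 / 2 ^ Suc n :: real)" by simp
    then show ?thesis using g z(2) unfolding 3 by argo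
  next
    case 4
    have "1 / 2 ^ (2 * (Suc n + 1)) < x (Suc n)" using x[of "Suc n"] by simp
    with pow[OF 4] le z(2) show ?thesis by simp
  qed
qed

section \<open>Partial sums of the series of steps\<close>

text \<open>The distance dominates the supremum norm of the difference. Hence a limit in
  \<open>D1 X\<close>, if there is one, must be the pointwise limit.\<close>

lemma limitin_D1_imp_tendsto:
  assumes X: "perfect_compact X"
    and \<sigma>: "limitin (Metric_space.mtopology (D1 X) (D1_dist X)) \<sigma> f sequentially" and z: "z \<in> X"
  shows "(\<lambda>k. \<sigma> k z) \<longlonglongrightarrow> f z"
proof -
  interpret Metric_space "D1 X" "D1_dist X"
    by (rule Metric_space_D1[OF X])
  have lim: "f \<in> D1 X" "eventually (\<lambda>k. \<sigma> k \<in> D1 X) sequentially"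
    "(\<lambda>k. D1_dist X (\<sigma> k) f) \<longlonglongrightarrow> 0"
    using \<sigma> by (auto simp: limitin_metric_dist_null)
  have comp: "compact X" "X \<noteq> {}"
    using X by (auto simp: perfect_compact_def)
  have "cmod (g z - f z) \<le> D1_dist X g f" if g: "g \<in> D1 X" for g
  proof -
    have "cmod (g z - f z) \<le> sup_norm_on X (\<lambda>z. g z - f z)"
      by (rule sup_norm_on_upper) (intro comp continuous_intros D1_continuous_on g lim z)+
    moreover have "0 \<le> sup_norm_on X (\<lambda>z. cderiv X g z - cderiv X f z)"
      by (intro sup_norm_on_nonneg comp continuous_intros D1_continuous_on g lim)
    ultimately show ?thesis by (simp add: D1_dist_eq[OF X g lim(1)])
  qed
  then have "eventually (\<lambda>k. norm (\<sigma> k z - f z) \<le> D1_dist X (\<sigma> k) f) sequentially"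
    using lim(2) by (auto elim: eventually_mono)
  from Lim_null_comparison[OF this lim(3)] show ?thesis
    by (simp add: LIM_zero_iff)
qed

lemma cmod_sum_cmult_diff_le:
  fixes c :: "nat \<Rightarrow> real" and g :: "nat \<Rightarrow> complex"
  assumes "j \<le> k" "\<And>n. n \<ge> 1 \<Longrightarrow> cmod (of_real (c n) * g n) \<le> u n" "\<And>n. 0 \<le> u n"
  shows "cmod ((\<Sum>n=1..<k. of_real (c n) * g n) - (\<Sum>n=1..<j. of_real (c n) * g n)) \<le> sum u {j..<k}"
proof -
  let ?t = "\<lambda>n. of_real (c n) * g n"
  \<comment> \<open>For \<open>j = 0\<close> the subtracted sum is empty and the difference still
    starts at 1, hence the maximum.\<close>
  have "sum ?t {1..<k} - sum ?t {1..<j} = sum ?t {max 1 j..<k}"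
  proof (cases "1 \<le> j")
    case True
    then show ?thesis using sum_diff_nat_ivl[of 1 j k ?t] assms(1) by (simp add: max_def)
  qed auto
  also have "cmod \<dots> \<le> sum u {max 1 j..<k}"
    using assms(2) by (intro sum_norm_le) auto
  also have "\<dots> \<le> sum u {j..<k}"
    using assms(3) by (intro sum_mono2) auto
  finally show ?thesis .
qed

text \<open>
  The summands start at the second ascending segment: nothing in the arc lies to the right of the first.
\<close>

definition step_sum :: "nat \<Rightarrow> complex \<Rightarrow> complex" where
  "step_sum k z = (\<Sum>n=1..<k. of_real (1 / 3 ^ n) * step (1 / 2 ^ (2 * Suc n)) (1 / 2 ^ Suc n) z)"

definition step_sum_deriv :: "nat \<Rightarrow> complex \<Rightarrow> complex" where
  "step_sum_deriv k z =
     (\<Sum>n=1..<k. of_real (1 / 3 ^ n) * step_deriv (1 / 2 ^ (2 * Suc n)) (1 / 2 ^ Suc n) z)"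

context
  fixes x :: "nat \<Rightarrow> real"
  assumes x: "\<And>n. n \<ge> 1 \<Longrightarrow> 1 / 2 ^ (2 * (n + 1)) < x n \<and> x n < 1 / 2 ^ (2 * n)"
begin

lemma perfect: "perfect_compact (arc_image x)"
  by (rule perfect_compact_arc_image[OF x])

lemma zero_mem: "0 \<in> arc_image x"
  by (simp add: arc_image_def)

lemma vz_mem: "n \<ge> 1 \<Longrightarrow> vz n \<in> arc_image x"
  by (force simp: arc_image_def path_image_gamma_path)

lemma strip:
  "n \<ge> 1 \<Longrightarrow>
    vertical_segment_in_strip (arc_image x) (x (Suc n)) (x n) (1 / 2 ^ (2 * Suc n)) (1 / 2 ^ Suc n)"
  by (rule vertical_segment_in_strip_arc_image[OF x])

lemma step_sum_has_field_derivative: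
  assumes "w \<in> arc_image x"
  shows "(restrict (step_sum k) (arc_image x) has_field_derivative step_sum_deriv k w)
           (at w within arc_image x)"
\<comment> \<open>Any positive radius would do: the restriction changes no value on the arc.\<close>
proof (rule has_field_derivative_transform_within[where d = 1])
  show "(step_sum k has_field_derivative step_sum_deriv k w) (at w within arc_image x)"
    unfolding step_sum_def step_sum_deriv_def
    by (intro DERIV_sum DERIV_cmult step_has_field_derivative[OF strip assms]) auto
qed (use assms in auto)

lemma cderiv_step_sum:
  "w \<in> arc_image x \<Longrightarrow> cderiv (arc_image x) (restrict (step_sum k) (arc_image x)) w = step_sum_deriv k w"
  using perfect unfolding perfect_compact_def
  by (intro cderiv_eqI step_sum_has_field_derivative) auto

lemma step_sum_in_D1: "restrict (step_sum k) (arc_image x) \<in> D1 (arc_image x)"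
proof -
  have "continuous_on (arc_image x) (step_sum_deriv k)"
    unfolding step_sum_deriv_def
    by (intro continuous_intros step_deriv_continuous_on[OF strip]) auto
  then have "continuous_on (arc_image x)
      (cderiv (arc_image x) (restrict (step_sum k) (arc_image x)))"
    by (subst continuous_on_cong[OF refl cderiv_step_sum])
  then show ?thesis
    using step_sum_has_field_derivative by (auto simp: D1_def field_differentiable_def)
qed

text \<open>Step \<open>n\<close> has height \<open>1 / 2 ^ Suc n\<close>, so its derivative is at
  most \<open>4 * 2 ^ n\<close>. The weight has base 3 > 2 to make the derivatives summable, and 3 <
  4 to keep the difference quotients at the points \<open>vz n\<close> unbounded.\<close>

lemma D1_dist_step_sum_le:
  assumes "j \<le> k"
  shows "D1_dist (arc_image x) (restrict (step_sum k) (arc_image x)) (restrict (step_sum j) (arc_image x))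
           \<le> (\<Sum>n=j..<k. (1 / 3) ^ n) + (\<Sum>n=j..<k. 4 * (2 / 3) ^ n)"
proof -
  have ne: "arc_image x \<noteq> {}" using zero_mem by auto
  have "cmod (step_sum k z - step_sum j z) \<le> (\<Sum>n=j..<k. (1 / 3) ^ n)" if z: "z \<in> arc_image x" for z
    unfolding step_sum_def
  proof (rule cmod_sum_cmult_diff_le[OF assms])
    fix n :: nat assume "n \<ge> 1"
    define s where "s = step (1 / 2 ^ (2 * Suc n)) (1 / 2 ^ Suc n) z"
    have "cmod s \<le> 1"
      using step_bounds[OF strip[OF \<open>n \<ge> 1\<close>] z] by (simp add: s_def in_Reals_norm complex_is_Real_iff cmod_eq_Re)
    then show "cmod (of_real (1 / 3 ^ n) * step (1 / 2 ^ (2 * Suc n)) (1 / 2 ^ Suc n) z) \<le> (1 / 3) ^ n"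
      unfolding s_def[symmetric] by (simp add: norm_mult norm_divide norm_power power_divide divide_right_mono)
  qed auto
  moreover have "cmod (step_sum_deriv k z - step_sum_deriv j z) \<le> (\<Sum>n=j..<k. 4 * (2 / 3) ^ n)"
    if z: "z \<in> arc_image x" for z
    unfolding step_sum_deriv_def
  proof (rule cmod_sum_cmult_diff_le[OF assms])
    fix n :: nat assume "n \<ge> 1"
    define s where "s = step_deriv (1 / 2 ^ (2 * Suc n)) (1 / 2 ^ Suc n) z"
    have "cmod s \<le> 4 * 2 ^ n"
      using step_bounds(4)[OF strip[OF \<open>n \<ge> 1\<close>] z] by (simp add: s_def)
    then show "cmod (of_real (1 / 3 ^ n) * step_deriv (1 / 2 ^ (2 * Suc n)) (1 / 2 ^ Suc n) z) \<le> 4 * (2 / 3) ^ n"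
      unfolding s_def[symmetric] by (simp add: norm_mult norm_divide norm_power power_divide divide_right_mono)
  qed auto
  ultimately show ?thesis
    unfolding D1_dist_eq[OF perfect step_sum_in_D1 step_sum_in_D1] sup_norm_on_def
    by (intro add_mono cSUP_least ne) (auto simp: cderiv_step_sum)
qed

interpretation Metric_space "D1 (arc_image x)" "D1_dist (arc_image x)"
  by (rule Metric_space_D1[OF perfect])

lemma MCauchy_step_sum: "MCauchy (\<lambda>k. restrict (step_sum k) (arc_image x))"
  unfolding MCauchy_def
proof (intro conjI allI impI)
  show "range (\<lambda>k. restrict (step_sum k) (arc_image x)) \<subseteq> D1 (arc_image x)"
    using step_sum_in_D1 by auto
  fix e :: real assume e: "e > 0"
  \<comment> \<open>The distance of two partial sums is bounded by a block of this one convergent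
    series.\<close>
  let ?u = "\<lambda>n. (1 / 3) ^ n + 4 * (2 / 3) ^ n :: real"
  have "summable ?u" by (intro summable_add summable_mult summable_geometric) auto
  then obtain N where N: "\<And>m n. m \<ge> N \<Longrightarrow> norm (sum ?u {m..<n}) < e"
    using e unfolding summable_Cauchy by meson
  have less: "D1_dist (arc_image x) (restrict (step_sum k) (arc_image x)) (restrict (step_sum j) (arc_image x)) < e"
    if "N \<le> j" "j \<le> k" for j k
    using D1_dist_step_sum_le[OF that(2)] N[OF that(1), of k] by (simp add: sum.distrib)
  show "\<exists>N. \<forall>j k. N \<le> j \<longrightarrow> N \<le> k \<longrightarrow>
      D1_dist (arc_image x) (restrict (step_sum j) (arc_image x)) (restrict (step_sum k) (arc_image x)) < e"
  proof (intro exI allI impI)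
    fix j k assume "N \<le> j" "N \<le> k"
    with less[of j k] less[of k j]
    show "D1_dist (arc_image x) (restrict (step_sum j) (arc_image x)) (restrict (step_sum k) (arc_image x)) < e"
      using commute by (cases "j \<le> k") auto
  qed
qed

section \<open>Blow-up of the difference quotients at the origin\<close>

lemma step_sum_zero: "step_sum k 0 = 0"
  by (simp add: step_sum_def step_def)

text \<open>The point \<open>vz n\<close> lies to the right of the segment carrying step
  \<open>n\<close>, so that step equals 1 there. All other steps are nonnegative, so nothing
  cancels.\<close>

lemma Re_step_sum_vz:
  assumes "n \<ge> 1" "n < k"
  shows "1 / 3 ^ n \<le> Re (step_sum k (vz n))"
proof -
  let ?t = "\<lambda>n z. Re (of_real (1 / 3 ^ n) * step (1 / 2 ^ (2 * Suc n)) (1 / 2 ^ Suc n) z)"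
  have "?t n (vz n) = 1 / 3 ^ n"
    by (simp add: step_def vz_def divide_less_eq)
  moreover have "?t n (vz n) \<le> (\<Sum>m=1..<k. ?t m (vz n))"
  proof (rule member_le_sum)
    fix m assume "m \<in> {1..<k} - {n}"
    then show "0 \<le> ?t m (vz n)"
      using step_bounds(2)[OF strip vz_mem[OF assms(1)], of m] by simp
  qed (use assms in auto)
  ultimately show ?thesis by (simp add: step_sum_def)
qed

text \<open>A limit would vanish at 0 and have modulus at least \<open>1 / 3 ^ n\<close> at
  \<open>vz n\<close>, whose modulus is \<open>1 / 4 ^ n\<close>. The quotients then grow at least
  like \<open>(4 / 3) ^ n\<close>, against differentiability at 0.\<close>

lemma not_convergent_step_sum:
  "\<not> limitin mtopology (\<lambda>k. restrict (step_sum k) (arc_image x)) f sequentially"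
proof
  assume lim: "limitin mtopology (\<lambda>k. restrict (step_sum k) (arc_image x)) f sequentially"
  have ptw: "(\<lambda>k. step_sum k z) \<longlonglongrightarrow> f z" if "z \<in> arc_image x" for z
    using limitin_D1_imp_tendsto[OF perfect lim that] that by simp
  have f0: "f 0 = 0"
    using ptw[OF zero_mem] by (simp add: step_sum_zero LIMSEQ_const_iff)
  have fz: "1 / 3 ^ n \<le> cmod (f (vz n))" if n: "n \<ge> 1" for n
  proof -
    have "(\<lambda>k. Re (step_sum k (vz n))) \<longlonglongrightarrow> Re (f (vz n))"
      by (intro tendsto_Re ptw vz_mem n)
    then have "1 / 3 ^ n \<le> Re (f (vz n))"
      by (rule tendsto_lowerbound)
        (use Re_step_sum_vz[OF n] in \<open>auto intro: eventually_mono[OF eventually_gt_at_top[of n]]\<close>)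
    then show ?thesis using complex_Re_le_cmod order_trans by blast
  qed
  have "f \<in> D1 (arc_image x)" using lim by (simp add: limitin_metric)
  then obtain d where "(f has_field_derivative d) (at 0 within arc_image x)"
    using zero_mem by (auto simp: D1_def field_differentiable_def)
  then have d: "((\<lambda>z. f z / z) \<longlongrightarrow> d) (at 0 within arc_image x)"
    by (simp add: has_field_derivative_iff f0)
  have norm_vz: "cmod (vz n) = 1 / 4 ^ n" for n
    by (simp add: vz_def complex_norm power_mult)
  have vz0: "vz (Suc n) \<noteq> 0" for n by (simp add: vz_def complex_eq_iff)
  \<comment> \<open>The shift by \<open>Suc\<close> is needed because \<open>vz_mem\<close> and
    \<open>fz\<close> start at index 1.\<close>
  have "(\<lambda>n. 1 / 4 ^ Suc n :: real) \<longlonglongrightarrow> 0" by real_asymp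
  then have "(\<lambda>n. vz (Suc n)) \<longlonglongrightarrow> 0"
    by (intro tendsto_norm_zero_cancel[of "\<lambda>n. vz (Suc n)"]) (simp only: norm_vz)
  then have "filterlim (\<lambda>n. vz (Suc n)) (at 0 within arc_image x) sequentially"
    using vz0 vz_mem by (auto simp: filterlim_at)
  from tendsto_norm[OF filterlim_compose[OF d this]]
  have "(\<lambda>n. cmod (f (vz (Suc n)) / vz (Suc n))) \<longlonglongrightarrow> cmod d" .
  moreover have pow: "filterlim (\<lambda>n. (4 / 3) ^ Suc n :: real) at_top sequentially"
    by real_asymp
  have "(4 / 3) ^ Suc n \<le> cmod (f (vz (Suc n)) / vz (Suc n))" for n
    using mult_right_mono[OF fz[of "Suc n"], of "4 ^ Suc n"]
    by (simp add: norm_divide norm_vz power_divide)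
  then have "filterlim (\<lambda>n. cmod (f (vz (Suc n)) / vz (Suc n))) at_top sequentially"
    by (intro filterlim_at_top_mono[OF pow] always_eventually allI)
  then have "filterlim (\<lambda>n. cmod (f (vz (Suc n)) / vz (Suc n))) at_infinity sequentially"
    by (rule filterlim_at_top_imp_at_infinity)
  ultimately show False
    using not_tendsto_and_filterlim_at_infinity sequentially_bot by blast
qed

end

theorem theorem2p5:
  fixes x :: "nat \<Rightarrow> real"
  assumes "\<And>n. n \<ge> 1 \<Longrightarrow> 1 / 2 ^ (2 * (n + 1)) < x n \<and> x n < 1 / 2 ^ (2 * n)"
  shows "\<not> Metric_space.mcomplete (D1 (arc_image x)) (D1_dist (arc_image x))"
proof -
  interpret Metric_space "D1 (arc_image x)" "D1_dist (arc_image x)"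
    by (rule Metric_space_D1[OF perfect_compact_arc_image[OF assms]])
  show ?thesis
    using MCauchy_step_sum[OF assms] not_convergent_step_sum[OF assms] unfolding mcomplete_def by blast
qed

end
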